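(* Let $R\subseteq S$ be two commutative rings with $S$ flat over $R$. (1) Let $\mathcal{Q}_1=(J_1,V_1)$ be a saturated idealistic prime of $S$, $\mathcal{P}_1=(I_1,U_1)$ its trace on $R$ and $\mathcal{P}_0=(I_0,U_0)$ a saturated idealistic prime of $R$ with $I_0\subseteq I_1$. If the idealistic chain $(\mathcal{P}_0,\mathcal{Q}_1)$ collapses in $S$, then the idealistic prime $\mathcal{Q}_1$ collapses in $S$ (and a fortiori the idealistic prime $\mathcal{P}_1$ collapses in $R$). (2) Let $\mathcal{C}_1$ be a saturated idealistic chain of $R$ and $\mathcal{C}_2$ a saturated idealistic chain of $S$, non empty. Let $I_\ell$ be the last of the ideals in the chain $\mathcal{C}_1$ and $I_{\ell+1}$ the first of the ideals in the chain $\mathcal{C}_2|_R$. Assume $I_\ell\subseteq I_{\ell+1}$. If the idealistic chain $\mathcal{C}_1\bullet\mathcal{C}_2$ collapses in $S$, then the idealistic chain $\mathcal{C}_2$ collapses in $S$.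
   Context: For subsets $J,U$ of a ring $A$, $\langle J\rangle$ is the ideal generated by $J$ and $\mathcal{M}(U)$ the multiplicative monoid (containing $1$) generated by $U$. An idealistic prime in $A$ is a pair $(J,U)$ of subsets (identified with a chain with one member); an idealistic chain is a finite list $((J_0,U_0),\ldots,(J_k,U_k))$ of idealistic primes; its ideals are the $J_i$. It collapses in $A$ if there exist $j_i\in\langle J_i\rangle$, $u_i\in\mathcal{M}(U_i)$ with $u_0(u_1(\cdots(u_k+j_k)+\cdots)+j_1)+j_0=0$. A chain of $R$ is also regarded as a chain of $S\supseteq R$. $\bullet$ denotes concatenation of lists. A chain is complete if every $J_i$ is an ideal, every $U_i$ is a multiplicative monoid, $J_i+U_i=U_i$, and $J_i\subseteq J_{i+1}$, $U_{i+1}\subseteq U_i$. An ideal $I$ and a monoid $M$ are conjugate if: ($sa\in I$, $s\in M$ imply $a\in I$); ($a^n\in I$, $n>0$ imply $a\in I$); ($j\in I$, $s\in M$ imply $s+j\in M$); ($s_1s_2\in M$ implies $s_1\in M$). A chain (or idealistic prime) is saturated if it is complete and each $J_i$ and $U_i$ are conjugate. The trace on $R$ of an idealistic prime $(J,V)$ of $S$ is $(J\cap R,V\cap R)$; the trace $\mathcal{C}|_R$ of a chain $\mathcal{C}$ of $S$ is the list of the traces of its members. *)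

theory Defs
  imports "HOL-Algebra.Algebra"
begin

section \<open>Flat modules\<close>

definition module_maps ::
  "('a, 'r) ring_scheme \<Rightarrow> ('a, 'm, 'x) module_scheme \<Rightarrow> ('a, 'n, 'y) module_scheme \<Rightarrow> ('m \<Rightarrow> 'n) set"
  where "module_maps A M N =
    {f \<in> hom (add_monoid M) (add_monoid N).
      \<forall>a \<in> carrier A. \<forall>x \<in> carrier M. f (a \<odot>\<^bsub>M\<^esub> x) = a \<odot>\<^bsub>N\<^esub> f x}"

definition tensor_relators ::
  "('a, 'r) ring_scheme \<Rightarrow> ('a, 'm, 'x) module_scheme \<Rightarrow> ('a, 'n, 'y) module_scheme
    \<Rightarrow> ('m \<times> 'n \<Rightarrow>\<^sub>0 int) set"
  where "tensor_relators A M N =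
      {frag_of (x \<oplus>\<^bsub>M\<^esub> x', y) - frag_of (x, y) - frag_of (x', y) | x x' y.
        x \<in> carrier M \<and> x' \<in> carrier M \<and> y \<in> carrier N}
    \<union> {frag_of (x, y \<oplus>\<^bsub>N\<^esub> y') - frag_of (x, y) - frag_of (x, y') | x y y'.
        x \<in> carrier M \<and> y \<in> carrier N \<and> y' \<in> carrier N}
    \<union> {frag_of (a \<odot>\<^bsub>M\<^esub> x, y) - frag_of (x, a \<odot>\<^bsub>N\<^esub> y) | a x y.
        a \<in> carrier A \<and> x \<in> carrier M \<and> y \<in> carrier N}"

definition tensor_subgroup ::
  "('a, 'r) ring_scheme \<Rightarrow> ('a, 'm, 'x) module_scheme \<Rightarrow> ('a, 'n, 'y) module_scheme
    \<Rightarrow> ('m \<times> 'n \<Rightarrow>\<^sub>0 int) set"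
  where "tensor_subgroup A M N =
    generate (free_Abelian_group (carrier M \<times> carrier N)) (tensor_relators A M N)"

text \<open>The underlying abelian group of the tensor product, in multiplicative notation as for
  \<^const>\<open>free_Abelian_group\<close>; its scalar multiplication plays no role for injectivity.\<close>

definition tensor_product ::
  "('a, 'r) ring_scheme \<Rightarrow> ('a, 'm, 'x) module_scheme \<Rightarrow> ('a, 'n, 'y) module_scheme
    \<Rightarrow> ('m \<times> 'n \<Rightarrow>\<^sub>0 int) set monoid"
  where "tensor_product A M N =
    free_Abelian_group (carrier M \<times> carrier N) Mod tensor_subgroup A M N"

text \<open>The map induced by \<open>f : M \<rightarrow> N\<close> from the tensor product of \<open>M\<close> and \<open>P\<close> to that of \<open>N\<close> and \<open>P\<close>,
  which sends the class of \<open>(x, p)\<close> to the class of \<open>(f x, p)\<close>. Elements of the tensor product are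
  cosets, and all representatives of a coset have the same image when \<open>f\<close> is linear.\<close>

definition tensor_map ::
  "('a, 'r) ring_scheme \<Rightarrow> ('a, 'n, 'y) module_scheme \<Rightarrow> ('a, 'p, 'z) module_scheme
    \<Rightarrow> ('m \<Rightarrow> 'n) \<Rightarrow> ('m \<times> 'p \<Rightarrow>\<^sub>0 int) set \<Rightarrow> ('n \<times> 'p \<Rightarrow>\<^sub>0 int) set"
  where "tensor_map A N P f K =
    the_elem ((\<lambda>c. tensor_subgroup A N P #>\<^bsub>free_Abelian_group (carrier N \<times> carrier P)\<^esub>
      frag_extend (\<lambda>(x, p). frag_of (f x, p)) c) ` K)"

text \<open>\<open>P\<close> is flat if tensoring with \<open>P\<close> preserves injectivity of linear maps. A formula of HOL
  cannot quantify over the modules of all types, so the type of their elements is a parameter.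
  The notion does not depend on it as long as the type is large enough: since a vanishing
  relation in a tensor product involves finitely many elements only, a type that
  accommodates a copy of every finitely generated module is enough. For a ring with elements of type
  \<open>'a\<close>, such a type is \<open>'a list set\<close>: a finitely generated module is a quotient of some
  free module of rank \<open>n\<close>, hence isomorphic to a module of cosets of lists of length \<open>n\<close>.\<close>

definition flat_module ::
  "'m itself \<Rightarrow> ('a, 'r) ring_scheme \<Rightarrow> ('a, 'p, 'z) module_scheme \<Rightarrow> bool"
  where "flat_module T A P \<longleftrightarrow> module A P \<and>
    (\<forall>(M :: ('a, 'm) module) (N :: ('a, 'm) module) f.
      module A M \<and> module A N \<and> f \<in> module_maps A M N \<and> inj_on f (carrier M)
        \<longrightarrow> inj_on (tensor_map A N P f) (carrier (tensor_product A M P)))"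

definition ring_as_module :: "('a, 'r) ring_scheme \<Rightarrow> ('a, 'a) module"
  where "ring_as_module S =
    \<lparr>carrier = carrier S, monoid.mult = monoid.mult S, one = one S,
     ring.zero = ring.zero S, add = add S, smult = monoid.mult S\<rparr>"

definition flat_over :: "('a, 'r) ring_scheme \<Rightarrow> 'a set \<Rightarrow> bool"
  where "flat_over S R \<longleftrightarrow>
    flat_module TYPE('a list set) (S\<lparr>carrier := R\<rparr>) (ring_as_module S)"


section \<open>Idealistic chains\<close>

type_synonym 'a idealistic_prime = "'a set \<times> 'a set"
type_synonym 'a idealistic_chain = "'a idealistic_prime list"

definition genmonoid :: "('a, 'r) monoid_scheme \<Rightarrow> 'a set \<Rightarrow> 'a set"
  where "genmonoid A U = \<Inter>{M. submonoid M A \<and> U \<subseteq> M}"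

text \<open>The value \<open>u\<^sub>0 (u\<^sub>1 (\<dots> (u\<^sub>k + j\<^sub>k) \<dots>) + j\<^sub>1) + j\<^sub>0\<close>. The recursion ends with \<open>1\<close>, so that
  the innermost term is \<open>u\<^sub>k 1 + j\<^sub>k\<close>.\<close>

fun collapse_value :: "('a, 'r) ring_scheme \<Rightarrow> ('a \<times> 'a) list \<Rightarrow> 'a"
  where
    "collapse_value A [] = \<one>\<^bsub>A\<^esub>"
  | "collapse_value A ((j, u) # xs) = u \<otimes>\<^bsub>A\<^esub> collapse_value A xs \<oplus>\<^bsub>A\<^esub> j"

definition collapses :: "('a, 'r) ring_scheme \<Rightarrow> 'a idealistic_chain \<Rightarrow> bool"
  where "collapses A C \<longleftrightarrow>
    (\<exists>xs. list_all2 (\<lambda>(j, u) (J, U). j \<in> genideal A J \<and> u \<in> genmonoid A U) xs C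
      \<and> collapse_value A xs = \<zero>\<^bsub>A\<^esub>)"

definition complete_chain :: "('a, 'r) ring_scheme \<Rightarrow> 'a idealistic_chain \<Rightarrow> bool"
  where "complete_chain A C \<longleftrightarrow>
    (\<forall>(J, U) \<in> set C. ideal J A \<and> submonoid U A \<and> J <+>\<^bsub>A\<^esub> U = U) \<and>
    (\<forall>i. Suc i < length C \<longrightarrow>
      fst (C ! i) \<subseteq> fst (C ! Suc i) \<and> snd (C ! Suc i) \<subseteq> snd (C ! i))"

definition conjugate :: "('a, 'r) ring_scheme \<Rightarrow> 'a set \<Rightarrow> 'a set \<Rightarrow> bool"
  where "conjugate A I M \<longleftrightarrow>
    (\<forall>s \<in> M. \<forall>a \<in> carrier A. s \<otimes>\<^bsub>A\<^esub> a \<in> I \<longrightarrow> a \<in> I) \<and>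
    (\<forall>a \<in> carrier A. \<forall>n > (0::nat). a [^]\<^bsub>A\<^esub> n \<in> I \<longrightarrow> a \<in> I) \<and>
    (\<forall>j \<in> I. \<forall>s \<in> M. s \<oplus>\<^bsub>A\<^esub> j \<in> M) \<and>
    (\<forall>s\<^sub>1 \<in> carrier A. \<forall>s\<^sub>2 \<in> carrier A. s\<^sub>1 \<otimes>\<^bsub>A\<^esub> s\<^sub>2 \<in> M \<longrightarrow> s\<^sub>1 \<in> M)"

definition saturated :: "('a, 'r) ring_scheme \<Rightarrow> 'a idealistic_chain \<Rightarrow> bool"
  where "saturated A C \<longleftrightarrow>
    complete_chain A C \<and> (\<forall>(J, U) \<in> set C. conjugate A J U)"

definition trace_prime :: "'a set \<Rightarrow> 'a idealistic_prime \<Rightarrow> 'a idealistic_prime"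
  where "trace_prime R P = (fst P \<inter> R, snd P \<inter> R)"

definition trace_chain :: "'a set \<Rightarrow> 'a idealistic_chain \<Rightarrow> 'a idealistic_chain"
  where "trace_chain R C = map (trace_prime R) C"

end

theory Submission
  imports Defs
begin

text \<open>Let \<open>I\<close> be an ideal of \<open>R\<close> and \<open>u \<in> R\<close> such that \<open>u a \<in> I\<close> implies \<open>a \<in> I\<close>. Then
  multiplication by \<open>u\<close> is injective on \<open>R/I\<close>, hence by flatness on the tensor product of \<open>R/I\<close> and
  \<open>S\<close>, in which the class of \<open>(1, y)\<close> vanishes if and only if \<open>y \<in> I S\<close>. So \<open>u y \<in> I S\<close> implies
  \<open>y \<in> I S\<close>. Applied to each layer of a collapse of \<open>C\<^sub>1 \<bullet> C\<^sub>2\<close>, this shows that the part of the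
  collapse that belongs to \<open>C\<^sub>2\<close> has its value in \<open>I\<^sub>\<ell> S\<close>, which lies in the first ideal
  of \<open>C\<^sub>2\<close>; subtracting this value from \<open>j\<close> in the first layer gives a collapse of \<open>C\<^sub>2\<close>.\<close>

section \<open>Tensor products\<close>

lemma tensor_relators_closed:
  assumes "module A M" "module A N"
  shows "tensor_relators A M N \<subseteq> carrier (free_Abelian_group (carrier M \<times> carrier N))"
proof -
  interpret M: module A M by fact
  interpret N: module A N by fact
  have *: "Poly_Mapping.keys (frag_of p - frag_of q - frag_of r) \<subseteq> B" 
    if "p \<in> B" "q \<in> B" "r \<in> B" for p q r and B :: "('c \<times> 'e) set"
    by (intro order_trans[OF keys_diff] Un_least) (use that in auto)
  have **: "Poly_Mapping.keys (frag_of p - frag_of q) \<subseteq> B" 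
    if "p \<in> B" "q \<in> B" for p q and B :: "('c \<times> 'e) set"
    by (intro order_trans[OF keys_diff] Un_least) (use that in auto)
  show ?thesis
    unfolding tensor_relators_def
    by (safe; simp only: carrier_free_Abelian_group_iff; (rule * | rule **); simp)
qed

lemma subgroup_tensor_subgroup:
  assumes "module A M" "module A N"
  shows "subgroup (tensor_subgroup A M N) (free_Abelian_group (carrier M \<times> carrier N))"
  unfolding tensor_subgroup_def
  by (rule group.generate_is_subgroup[OF group_free_Abelian_group tensor_relators_closed[OF assms]])

text \<open>The preimage of \<open>K\<close> under \<open>h\<close> is a subgroup, so it contains
  everything generated by the relators once it contains these. It is applied with \<open>K\<close>
  trivial, for maps out of a tensor product, and with \<open>K\<close> another
  \<open>tensor_subgroup\<close>, for maps between tensor products.\<close>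

lemma tensor_subgroup_subset_hom_kernel:
  assumes M: "module A M" and N: "module A N" and G: "group G"
    and h: "h \<in> hom (free_Abelian_group (carrier M \<times> carrier N)) G"
    and K: "subgroup K G"
    and rel: "h ` tensor_relators A M N \<subseteq> K"
    and c: "c \<in> tensor_subgroup A M N"
  shows "h c \<in> K"
proof -
  let ?F = "free_Abelian_group (carrier M \<times> carrier N)"
  interpret h: group_hom ?F G h
    using G h by (simp add: group_hom_def group_hom_axioms_def)
  have "generate ?F (tensor_relators A M N) \<subseteq> {x \<in> carrier ?F. h x \<in> K}"
  proof (rule group.generate_subgroup_incl[OF group_free_Abelian_group])
    show "tensor_relators A M N \<subseteq> {x \<in> carrier ?F. h x \<in> K}"
      using rel tensor_relators_closed[OF M N] by blast
    show "subgroup {x \<in> carrier ?F. h x \<in> K} ?F"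
    proof (rule group.subgroupI[OF group_free_Abelian_group])
      have "0 \<in> {x \<in> carrier ?F. h x \<in> K}"
        using h.hom_one subgroup.one_closed[OF K] by simp
      then show "{x \<in> carrier ?F. h x \<in> K} \<noteq> {}"
        by blast
    next
      fix x assume "x \<in> {x \<in> carrier ?F. h x \<in> K}"
      then show "inv\<^bsub>?F\<^esub> x \<in> {x \<in> carrier ?F. h x \<in> K}"
        using h.hom_inv[of x] subgroup.m_inv_closed[OF K, of "h x"] by simp
    next
      fix x y assume "x \<in> {x \<in> carrier ?F. h x \<in> K}" "y \<in> {x \<in> carrier ?F. h x \<in> K}"
      then show "x \<otimes>\<^bsub>?F\<^esub> y \<in> {x \<in> carrier ?F. h x \<in> K}"
        using h.hom_mult[of x y] subgroup.m_closed[OF K, of "h x" "h y"]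
          order_trans[OF keys_add[of x y]] by simp
    qed (auto simp del: mult_free_Abelian_group)
  qed
  then show ?thesis
    using c unfolding tensor_subgroup_def by blast
qed

text \<open>The part of the universal property that detects elements which do not vanish. The
  extension of \<open>g\<close> to the free abelian group kills every relator, hence the whole
  \<open>tensor_subgroup\<close>.\<close>

lemma balanced_map_eq_one:
  assumes M: "module A M" and N: "module A N" and G: "comm_group G"
    and closed: "\<And>x y. x \<in> carrier M \<Longrightarrow> y \<in> carrier N \<Longrightarrow> g (x, y) \<in> carrier G"
    and left: "\<And>x x' y. x \<in> carrier M \<Longrightarrow> x' \<in> carrier M \<Longrightarrow> y \<in> carrier N \<Longrightarrow>
      g (x \<oplus>\<^bsub>M\<^esub> x', y) = g (x, y) \<otimes>\<^bsub>G\<^esub> g (x', y)"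
    and right: "\<And>x y y'. x \<in> carrier M \<Longrightarrow> y \<in> carrier N \<Longrightarrow> y' \<in> carrier N \<Longrightarrow>
      g (x, y \<oplus>\<^bsub>N\<^esub> y') = g (x, y) \<otimes>\<^bsub>G\<^esub> g (x, y')"
    and balanced: "\<And>a x y. a \<in> carrier A \<Longrightarrow> x \<in> carrier M \<Longrightarrow> y \<in> carrier N \<Longrightarrow>
      g (a \<odot>\<^bsub>M\<^esub> x, y) = g (x, a \<odot>\<^bsub>N\<^esub> y)"
    and xy: "x \<in> carrier M" "y \<in> carrier N" "frag_of (x, y) \<in> tensor_subgroup A M N"
  shows "g (x, y) = \<one>\<^bsub>G\<^esub>"
proof -
  let ?F = "free_Abelian_group (carrier M \<times> carrier N)"
  interpret M: module A M by fact
  interpret N: module A N by fact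
  interpret G: comm_group G by fact
  obtain h where h: "h \<in> hom ?F G"
    and hg: "\<And>p. p \<in> carrier M \<times> carrier N \<Longrightarrow> h (frag_of p) = g p"
    using G.free_Abelian_group_universal[of g "carrier M \<times> carrier N"] closed
    by (metis (no_types, lifting) image_subsetI mem_Sigma_iff prod.exhaust)
  interpret h: group_hom ?F G h
    using h by (simp add: group_hom_def group_hom_axioms_def)
  have diff: "h (p - q) = h p \<otimes>\<^bsub>G\<^esub> inv\<^bsub>G\<^esub> h q" if "p \<in> carrier ?F" "q \<in> carrier ?F" for p q
    using h.hom_mult[of p "inv\<^bsub>?F\<^esub> q"] h.hom_inv[of q] that by simp
  have diff_closed: "p - q \<in> carrier ?F" if "p \<in> carrier ?F" "q \<in> carrier ?F" for p q
    using order_trans[OF keys_diff[of p q]] that by simp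
  \<comment> \<open>This is the form in which the images of the two additivity relators appear:
    \<open>left\<close> or \<open>right\<close> turns the first generator into a product
    \<open>a b\<close>, and the two subtracted generators contribute the inverses.\<close>
  have cancel: "a \<otimes>\<^bsub>G\<^esub> (b \<otimes>\<^bsub>G\<^esub> (inv\<^bsub>G\<^esub> a \<otimes>\<^bsub>G\<^esub> inv\<^bsub>G\<^esub> b)) = \<one>\<^bsub>G\<^esub>"
    if "a \<in> carrier G" "b \<in> carrier G" for a b
    using G.r_inv[of "a \<otimes>\<^bsub>G\<^esub> b"] that by (simp add: G.inv_mult G.m_assoc)
  have "h ` tensor_relators A M N \<subseteq> {\<one>\<^bsub>G\<^esub>}"
    unfolding tensor_relators_def
    by (auto simp: diff diff_closed hg closed left right balanced cancel G.m_assoc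
          simp del: carrier_free_Abelian_group_iff)
  then have "h (frag_of (x, y)) \<in> {\<one>\<^bsub>G\<^esub>}"
    by (intro tensor_subgroup_subset_hom_kernel[OF M N G.group_axioms h G.triv_subgroup _ xy(3)])
  then show ?thesis
    using hg xy by simp
qed

text \<open>Well-definedness of \<open>tensor_map\<close>. The induced map \<open>e\<close> of free
  abelian groups carries relators to relators, hence one subgroup into the other, so all
  representatives of a coset yield the same coset.\<close>

lemma tensor_map_coset:
  fixes M :: "('a, 'm, 'x) module_scheme" and N :: "('a, 'n, 'y) module_scheme"
    and P :: "('a, 'p, 'z) module_scheme"
  assumes M: "module A M" and N: "module A N" and P: "module A P"
    and f: "f \<in> module_maps A M N"
    and c: "c \<in> carrier (free_Abelian_group (carrier M \<times> carrier P))"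
  shows "tensor_map A N P f
      (tensor_subgroup A M P #>\<^bsub>free_Abelian_group (carrier M \<times> carrier P)\<^esub> c) =
    tensor_subgroup A N P #>\<^bsub>free_Abelian_group (carrier N \<times> carrier P)\<^esub>
      frag_extend (\<lambda>(x, p). frag_of (f x, p)) c"
proof -
  let ?F = "free_Abelian_group (carrier M \<times> carrier P)"
  let ?G = "free_Abelian_group (carrier N \<times> carrier P)"
  let ?H = "tensor_subgroup A M P"
  let ?K = "tensor_subgroup A N P"
  define e :: "('m \<times> 'p \<Rightarrow>\<^sub>0 int) \<Rightarrow> ('n \<times> 'p \<Rightarrow>\<^sub>0 int)"
    where "e = frag_extend (\<lambda>(x, p). frag_of (f x, p))"
  interpret M: module A M by fact
  interpret N: module A N by fact
  interpret P: module A P by fact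
  interpret G: comm_group ?G by (rule abelian_free_Abelian_group)
  have K: "subgroup ?K ?G"
    by (rule subgroup_tensor_subgroup[OF N P])
  have H: "subgroup ?H ?F"
    by (rule subgroup_tensor_subgroup[OF M P])
  have fM: "f x \<in> carrier N" if "x \<in> carrier M" for x
    using f that unfolding module_maps_def hom_def by auto
  have fadd: "f (x \<oplus>\<^bsub>M\<^esub> y) = f x \<oplus>\<^bsub>N\<^esub> f y" if "x \<in> carrier M" "y \<in> carrier M" for x y
    using f that unfolding module_maps_def hom_def by auto
  have fsmult: "f (a \<odot>\<^bsub>M\<^esub> x) = a \<odot>\<^bsub>N\<^esub> f x" if "a \<in> carrier A" "x \<in> carrier M" for a x
    using f that unfolding module_maps_def by auto
  have e_closed: "e d \<in> carrier ?G" if "d \<in> carrier ?F" for d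
  proof -
    have "Poly_Mapping.keys (e d) \<subseteq>
        (\<Union>q\<in>Poly_Mapping.keys d. Poly_Mapping.keys (case q of (x, p) \<Rightarrow> frag_of (f x, p)))"
      unfolding e_def by (rule keys_frag_extend)
    also have "\<dots> \<subseteq> carrier N \<times> carrier P"
    proof (rule UN_least)
      fix q assume "q \<in> Poly_Mapping.keys d"
      then have "q \<in> carrier M \<times> carrier P"
        using that by auto
      then show "Poly_Mapping.keys (case q of (x, p) \<Rightarrow> frag_of (f x, p)) \<subseteq> carrier N \<times> carrier P"
        using fM by (cases q) simp
    qed
    finally show ?thesis
      by simp
  qed
  have e_hom: "e \<in> hom ?F ?G"
    by (rule homI) (use e_closed in \<open>simp_all add: e_def frag_extend_add\<close>)
  \<comment> \<open>Linearity of \<open>f\<close> turns each relator into a relator of the same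
    kind.\<close>
  have "e ` tensor_relators A M P \<subseteq> tensor_relators A N P"
  proof (rule image_subsetI)
    fix d assume "d \<in> tensor_relators A M P"
    then show "e d \<in> tensor_relators A N P"
      unfolding tensor_relators_def e_def
      by (elim UnE CollectE exE conjE)
        (simp_all add: frag_extend_diff fadd fsmult, (use fM in blast)+)
  qed
  moreover have "tensor_relators A N P \<subseteq> ?K"
    unfolding tensor_subgroup_def by (blast intro: generate.incl)
  ultimately have e_H: "e d \<in> ?K" if "d \<in> ?H" for d
    using tensor_subgroup_subset_hom_kernel[OF M P G.group_axioms e_hom K _ that] by blast
  have "?K #>\<^bsub>?G\<^esub> e d = ?K #>\<^bsub>?G\<^esub> e c" if d: "d \<in> ?H #>\<^bsub>?F\<^esub> c" for d
  proof -
    obtain b where b: "b \<in> ?H" "d = b \<otimes>\<^bsub>?F\<^esub> c"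
      using d unfolding r_coset_def by (elim UN_E singletonE)
    then have "e d = e b \<otimes>\<^bsub>?G\<^esub> e c"
      unfolding e_def by (simp add: frag_extend_add)
    then have "e d \<in> ?K #>\<^bsub>?G\<^esub> e c"
      using group.rcosI[OF group_free_Abelian_group e_H[OF b(1)] subgroup.subset[OF K] e_closed[OF c]]
      by simp
    then show ?thesis
      using G.repr_independence[OF _ e_closed[OF c] K] by simp
  qed
  \<comment> \<open>Together with the constancy just shown, nonemptiness makes the image a
    singleton, which is what \<open>the_elem\<close> requires.\<close>
  moreover have "c \<in> ?H #>\<^bsub>?F\<^esub> c"
    by (rule group.rcos_self[OF group_free_Abelian_group c H])
  ultimately have "(\<lambda>d. ?K #>\<^bsub>?G\<^esub> e d) ` (?H #>\<^bsub>?F\<^esub> c) = {?K #>\<^bsub>?G\<^esub> e c}"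
    by blast
  then show ?thesis
    unfolding tensor_map_def e_def by simp
qed

text \<open>Both the coset of \<open>(x, p)\<close> and that of \<open>0\<close> are sent to the
  trivial coset, so injectivity of \<open>tensor_map\<close> identifies them. \<open>M\<close> and
  \<open>N\<close> share one element type because \<open>flat_module\<close> quantifies over such
  pairs.\<close>

lemma flat_module_reflects_zero:
  fixes M N :: "('a, 'm) module"
  assumes flat: "flat_module TYPE('m) A P"
    and M: "module A M" and N: "module A N"
    and f: "f \<in> module_maps A M N" "inj_on f (carrier M)"
    and x: "x \<in> carrier M" and p: "p \<in> carrier P"
    and zero: "frag_of (f x, p) \<in> tensor_subgroup A N P"
  shows "frag_of (x, p) \<in> tensor_subgroup A M P"
proof -
  let ?F = "free_Abelian_group (carrier M \<times> carrier P)"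
  let ?G = "free_Abelian_group (carrier N \<times> carrier P)"
  let ?H = "tensor_subgroup A M P"
  let ?K = "tensor_subgroup A N P"
  have P: "module A P" and inj: "inj_on (tensor_map A N P f) (carrier (tensor_product A M P))"
    using flat M N f unfolding flat_module_def by blast+
  have K: "subgroup ?K ?G"
    by (rule subgroup_tensor_subgroup[OF N P])
  have H: "subgroup ?H ?F"
    by (rule subgroup_tensor_subgroup[OF M P])
  have c: "frag_of (x, p) \<in> carrier ?F" "(0 :: ('m \<times> 'c) \<Rightarrow>\<^sub>0 int) \<in> carrier ?F"
    using x p by simp_all
  have G0: "?K #>\<^bsub>?G\<^esub> 0 = ?K" 
    using group.coset_join2[OF group_free_Abelian_group _ K, of 0] subgroup.one_closed[OF K] by simp
  have "tensor_map A N P f (?H #>\<^bsub>?F\<^esub> frag_of (x, p)) = ?K #>\<^bsub>?G\<^esub> frag_of (f x, p)"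
    by (subst tensor_map_coset[OF M N P f(1) c(1)]) simp
  also have "\<dots> = ?K"
    using group.coset_join2[OF group_free_Abelian_group _ K zero] subgroup.mem_carrier[OF K zero]
    by blast
  also have "\<dots> = tensor_map A N P f (?H #>\<^bsub>?F\<^esub> 0)"
    by (subst tensor_map_coset[OF M N P f(1) c(2)]) (simp add: G0)
  finally have "?H #>\<^bsub>?F\<^esub> frag_of (x, p) = ?H #>\<^bsub>?F\<^esub> 0"
    using inj c unfolding tensor_product_def FactGroup_def inj_on_def RCOSETS_def by auto
  also have "\<dots> = ?H"
    using group.coset_join2[OF group_free_Abelian_group c(2) H] subgroup.one_closed[OF H] by simp
  finally show ?thesis
    using group.rcos_self[OF group_free_Abelian_group c(1) H] by simp
qed

section \<open>Cyclic modules\<close>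

text \<open>The quotient of \<open>A\<close> by \<open>I\<close>, with cosets coded as sets of one-element lists, so that it lives
  in the type over which \<^const>\<open>flat_over\<close> quantifies.\<close>

definition cyclic_class :: "('a, 'r) ring_scheme \<Rightarrow> 'a set \<Rightarrow> 'a \<Rightarrow> 'a list set"
  where "cyclic_class A I r = (\<lambda>x. [x]) ` (I +>\<^bsub>A\<^esub> r)"

text \<open>\<open>hd\<close> undoes the coding by one-element lists, so the operations are those of
  the quotient ring, and a scalar \<open>a\<close> acts as multiplication by its coset.\<close>

definition cyclic_module :: "('a, 'r) ring_scheme \<Rightarrow> 'a set \<Rightarrow> ('a, 'a list set) module"
  where "cyclic_module A I =
    \<lparr>carrier = cyclic_class A I ` carrier A,
     monoid.mult = undefined, one = undefined,
     ring.zero = cyclic_class A I \<zero>\<^bsub>A\<^esub>,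
     add = (\<lambda>K L. (\<lambda>x. [x]) ` ((hd ` K) <+>\<^bsub>A\<^esub> (hd ` L))),
     smult = (\<lambda>a K. (\<lambda>x. [x]) ` rcoset_mult A I (I +>\<^bsub>A\<^esub> a) (hd ` K))\<rparr>"

lemma carrier_cyclic_module: "carrier (cyclic_module A I) = cyclic_class A I ` carrier A"
  by (simp add: cyclic_module_def)

lemma zero_cyclic_module: "\<zero>\<^bsub>cyclic_module A I\<^esub> = cyclic_class A I \<zero>\<^bsub>A\<^esub>"
  by (simp add: cyclic_module_def)

context ideal
begin

lemma add_cyclic_class:
  assumes "r \<in> carrier R" "s \<in> carrier R"
  shows "cyclic_class R I r \<oplus>\<^bsub>cyclic_module R I\<^esub> cyclic_class R I s = cyclic_class R I (r \<oplus> s)"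
  using assms by (simp add: cyclic_module_def cyclic_class_def image_image a_rcos_sum)

lemma smult_cyclic_class:
  assumes "a \<in> carrier R" "r \<in> carrier R"
  shows "a \<odot>\<^bsub>cyclic_module R I\<^esub> cyclic_class R I r = cyclic_class R I (a \<otimes> r)"
  using assms by (simp add: cyclic_module_def cyclic_class_def image_image rcoset_mult_add)

lemma cyclic_class_eq_iff:
  assumes "r \<in> carrier R" "s \<in> carrier R"
  shows "cyclic_class R I r = cyclic_class R I s \<longleftrightarrow> r \<ominus> s \<in> I"
proof -
  have "inj (\<lambda>x :: 'a. [x])"
    by (simp add: inj_def)
  then have "cyclic_class R I r = cyclic_class R I s \<longleftrightarrow> I +> r = I +> s"
    unfolding cyclic_class_def by (rule inj_image_eq_iff)
  also have "\<dots> \<longleftrightarrow> r \<ominus> s \<in> I"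
    using quotient_eq_iff_same_a_r_cos[OF ideal_axioms assms] by simp
  finally show ?thesis .
qed

lemma module_cyclic_module:
  assumes "cring R"
  shows "module R (cyclic_module R I)"
proof (rule moduleI[OF assms])
  show "abelian_group (cyclic_module R I)"
  proof (rule abelian_groupI)
    fix K assume "K \<in> carrier (cyclic_module R I)"
    then obtain r where r: "r \<in> carrier R" "K = cyclic_class R I r"
      by (auto simp: carrier_cyclic_module)
    then show "\<exists>L\<in>carrier (cyclic_module R I). L \<oplus>\<^bsub>cyclic_module R I\<^esub> K = \<zero>\<^bsub>cyclic_module R I\<^esub>"
      by (auto simp: carrier_cyclic_module zero_cyclic_module add_cyclic_class l_neg
          intro!: bexI[of _ "\<ominus> r"])
  qed (auto simp: carrier_cyclic_module zero_cyclic_module add_cyclic_class a_ac)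
qed (auto simp: carrier_cyclic_module add_cyclic_class smult_cyclic_class l_distr r_distr m_assoc)

end

section \<open>Flat extensions\<close>

locale cring_extension = cring S + subcring R S for S (structure) and R

context cring_extension
begin

abbreviation base where "base \<equiv> S\<lparr>carrier := R\<rparr>"

lemma cring_base: "cring base"
  using subcring_iff[OF subset] subcring_axioms by blast

lemma base_subset [simp]: "r \<in> R \<Longrightarrow> r \<in> carrier S"
  using subset by blast

lemma module_ring_as_module: "module base (ring_as_module S)"
proof (rule moduleI[OF cring_base])
  have "abelian_group S" ..
  then show "abelian_group (ring_as_module S)"
    by (auto intro!: abelian_groupI simp: ring_as_module_def a_ac)
qed (auto simp: ring_as_module_def l_distr r_distr m_assoc)

lemma base_closed [simp]:
  "r \<in> R \<Longrightarrow> \<ominus> r \<in> R" "r \<in> R \<Longrightarrow> s \<in> R \<Longrightarrow> r \<oplus> s \<in> R" "\<zero> \<in> R"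
  by (fact subcringE(5)[OF subcring_axioms] subcringE(7)[OF subcring_axioms]
      subcringE(2)[OF subcring_axioms])+

text \<open>Negation is defined by a description over the carrier, so unlike addition and
  multiplication it does not pass to \<open>base\<close> by definition; inverses in an additive
  subgroup are those of the whole group.\<close>

lemma minus_base:
  assumes "r \<in> R" "s \<in> R"
  shows "r \<ominus>\<^bsub>base\<^esub> s = r \<ominus> s"
proof -
  have "subgroup R (add_monoid S)" ..
  then have "\<ominus>\<^bsub>base\<^esub> s = \<ominus> s"
    using add.m_inv_consistent[of R s] assms by (simp add: a_inv_def)
  then show ?thesis
    by (simp add: a_minus_def)
qed

text \<open>The trace of the isomorphism between the tensor product of \<open>R/I\<close> and
  \<open>S\<close> and the quotient \<open>S/IS\<close>. One direction uses the balanced map sending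
  the class of \<open>r\<close> and \<open>s\<close> to the class of \<open>r s\<close>; for the
  other, the elements that vanish robustly form an ideal of \<open>S\<close> containing
  \<open>I\<close>.\<close>

lemma cyclic_tensor_eq_zero_iff:
  assumes I: "ideal I base" and y: "y \<in> carrier S"
  shows "frag_of (cyclic_class base I \<one>, y)
      \<in> tensor_subgroup base (cyclic_module base I) (ring_as_module S) \<longleftrightarrow> y \<in> Idl I"
proof -
  let ?M = "cyclic_module base I" and ?P = "ring_as_module S"
  let ?F = "free_Abelian_group (carrier ?M \<times> carrier ?P)"
  let ?H = "tensor_subgroup base ?M ?P"
  let ?cl = "cyclic_class base I"
  interpret I: ideal I base by fact
  interpret J: ideal "Idl I" S
    using I.a_subset by (intro genideal_ideal) auto
  have M: "module base ?M"
    by (rule I.module_cyclic_module[OF cring_base])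
  have IJ: "I \<subseteq> Idl I"
    using I.a_subset by (intro genideal_self) auto
  show ?thesis
  proof
    assume *: "frag_of (?cl \<one>, y) \<in> ?H"
    define Q where "Q = S Quot (Idl I)"
    interpret Q: cring Q
      unfolding Q_def by (rule J.quotient_is_cring) (rule is_cring)
    have q: "(+>) (Idl I) \<in> ring_hom S Q"
      unfolding Q_def by (rule J.rcos_ring_hom)
    \<comment> \<open>The class is multiplied through a chosen representative. By the next fact any
      other one serves as well, since two of them differ by an element of \<open>I\<close>.\<close>
    define g where "g = (\<lambda>(K, s). Idl I +> (SOME r. r \<in> R \<and> ?cl r = K) \<otimes> s)"
    have g: "g (?cl r, s) = Idl I +> r \<otimes> s" if "r \<in> R" "s \<in> carrier S" for r s
    proof -
      define t where "t = (SOME t. t \<in> R \<and> ?cl t = ?cl r)"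
      have t: "t \<in> R \<and> ?cl t = ?cl r"
        unfolding t_def by (rule someI[of _ r]) (use that in simp)
      then have "t \<ominus> r \<in> I"
        using I.cyclic_class_eq_iff[of t r] that minus_base by simp
      then have "(t \<ominus> r) \<otimes> s \<in> Idl I"
        using IJ that J.I_r_closed by blast
      then have "t \<otimes> s \<ominus> r \<otimes> s \<in> Idl I"
        using that t by (simp add: minus_eq l_distr l_minus)
      then show ?thesis
        using quotient_eq_iff_same_a_r_cos[OF J.ideal_axioms, of "t \<otimes> s" "r \<otimes> s"] that t
        by (simp add: g_def t_def)
    qed
    have "g (?cl \<one>, y) = \<one>\<^bsub>add_monoid Q\<^esub>"
    proof (rule balanced_map_eq_one[OF M module_ring_as_module Q.a_comm_group])
      have q_closed: "Idl I +> s \<in> carrier Q" if "s \<in> carrier S" for s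
        using ring_hom_closed[OF q that] .
      have q_add: "Idl I +> (s \<oplus> t) = (Idl I +> s) \<otimes>\<^bsub>add_monoid Q\<^esub> (Idl I +> t)"
        if "s \<in> carrier S" "t \<in> carrier S" for s t
        using ring_hom_add[OF q that] by simp
      show "g (K, s) \<in> carrier (add_monoid Q)"
        if "K \<in> carrier ?M" "s \<in> carrier ?P" for K s
        using that by (auto simp: carrier_cyclic_module ring_as_module_def g
            intro!: q_closed[simplified])
      show "g (K \<oplus>\<^bsub>?M\<^esub> L, s) = g (K, s) \<otimes>\<^bsub>add_monoid Q\<^esub> g (L, s)"
        if KL: "K \<in> carrier ?M" "L \<in> carrier ?M" and s: "s \<in> carrier ?P" for K L s
      proof -
        obtain k l where k: "k \<in> R" "K = ?cl k" and l: "l \<in> R" "L = ?cl l"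
          using KL by (auto simp: carrier_cyclic_module)
        have "K \<oplus>\<^bsub>?M\<^esub> L = ?cl (k \<oplus> l)"
          using I.add_cyclic_class[of k l] k l by simp
        then have "g (K \<oplus>\<^bsub>?M\<^esub> L, s) = Idl I +> (k \<otimes> s \<oplus> l \<otimes> s)"
          using g[of "k \<oplus> l" s] k l s l_distr[of k l s] by (simp add: ring_as_module_def)
        also have "\<dots> = g (K, s) \<otimes>\<^bsub>add_monoid Q\<^esub> g (L, s)"
          using q_add[of "k \<otimes> s" "l \<otimes> s"] g k l s
          by (simp add: ring_as_module_def)
        finally show ?thesis .
      qed
      show "g (K, s \<oplus>\<^bsub>?P\<^esub> t) = g (K, s) \<otimes>\<^bsub>add_monoid Q\<^esub> g (K, t)"
        if K: "K \<in> carrier ?M" and st: "s \<in> carrier ?P" "t \<in> carrier ?P" for K s t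
      proof -
        obtain k where k: "k \<in> R" "K = ?cl k"
          using K by (auto simp: carrier_cyclic_module)
        have "g (K, s \<oplus>\<^bsub>?P\<^esub> t) = Idl I +> (k \<otimes> s \<oplus> k \<otimes> t)"
          using g[of k "s \<oplus> t"] k st r_distr[of s t k] by (simp add: ring_as_module_def)
        also have "\<dots> = g (K, s) \<otimes>\<^bsub>add_monoid Q\<^esub> g (K, t)"
          using q_add[of "k \<otimes> s" "k \<otimes> t"] g k st
          by (simp add: ring_as_module_def)
        finally show ?thesis .
      qed
      show "g (a \<odot>\<^bsub>?M\<^esub> K, s) = g (K, a \<odot>\<^bsub>?P\<^esub> s)"
        if a: "a \<in> carrier base" and K: "K \<in> carrier ?M" and s: "s \<in> carrier ?P" for a K s
      proof -
        obtain k where k: "k \<in> R" "K = ?cl k"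
          using K by (auto simp: carrier_cyclic_module)
        have "a \<odot>\<^bsub>?M\<^esub> K = ?cl (a \<otimes> k)"
          using I.smult_cyclic_class[of a k] a k by simp
        then have "g (a \<odot>\<^bsub>?M\<^esub> K, s) = Idl I +> (a \<otimes> k) \<otimes> s"
          using g[of "a \<otimes> k" s] a k s by (simp add: ring_as_module_def)
        also have "(a \<otimes> k) \<otimes> s = k \<otimes> (a \<otimes> s)"
          using a k s m_ac(1)[of k a s] m_comm[of a k] by (simp add: ring_as_module_def)
        also have "Idl I +> \<dots> = g (K, a \<odot>\<^bsub>?P\<^esub> s)"
          using g[of k "a \<otimes> s"] a k s by (simp add: ring_as_module_def)
        finally show ?thesis .
      qed
      show "?cl \<one> \<in> carrier ?M" "y \<in> carrier ?P"
        using y by (auto simp: carrier_cyclic_module ring_as_module_def)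
      show "frag_of (?cl \<one>, y) \<in> ?H" by fact
    qed
    then have "Idl I +> y = Idl I"
      using g[of \<one> y] y by (simp add: Q_def FactRing_def)
    then show "y \<in> Idl I"
      using J.a_rcos_self[OF y] by simp
  next
    assume yI: "y \<in> Idl I"
    have H: "subgroup ?H ?F"
      by (rule subgroup_tensor_subgroup[OF M module_ring_as_module])
    have rel: "d \<in> ?H" if "d \<in> tensor_relators base ?M ?P" for d
      using that unfolding tensor_subgroup_def by (rule generate.incl)
    have plus: "c + d \<in> ?H" if "c \<in> ?H" "d \<in> ?H" for c d
      using subgroup.m_closed[OF H that] by simp
    have minus: "- c \<in> ?H" if "c \<in> ?H" for c
      using subgroup.m_inv_closed[OF H that] subgroup.mem_carrier[OF H that] by simp
    have cl1: "?cl \<one> \<in> carrier ?M" and cl0: "?cl \<zero> \<in> carrier ?M"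
      by (auto simp: carrier_cyclic_module)
    \<comment> \<open>The factor \<open>t\<close> makes \<open>T\<close> closed under multiplication by \<open>S\<close> without an action of \<open>S\<close> on the
      tensor product.\<close>
    define T where "T = {s \<in> carrier S. \<forall>t\<in>carrier S. frag_of (?cl \<one>, s \<otimes> t) \<in> ?H}"
    have add: "frag_of (?cl \<one>, s \<oplus> s') - frag_of (?cl \<one>, s) - frag_of (?cl \<one>, s') \<in> ?H"
      if "s \<in> carrier S" "s' \<in> carrier S" for s s'
      using that cl1 by (intro rel) (auto simp: tensor_relators_def ring_as_module_def)
    have T_add: "frag_of (?cl \<one>, s \<oplus> s') \<in> ?H"
      if "s \<in> carrier S" "s' \<in> carrier S" "frag_of (?cl \<one>, s) \<in> ?H" "frag_of (?cl \<one>, s') \<in> ?H"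
      for s s'
      using plus[OF plus[OF add[OF that(1,2)] that(3)] that(4)] by simp
    \<comment> \<open>For \<open>s = s' = \<zero>\<close> the additivity relator collapses to minus
      the generator in question.\<close>
    have T_zero: "frag_of (?cl \<one>, \<zero>) \<in> ?H"
      using minus[OF add[of \<zero> \<zero>]] by simp
    have T_ideal: "ideal T S"
    proof (rule idealI[OF ring_axioms])
      show "subgroup T (add_monoid S)"
      proof (rule add.subgroupI)
        fix s assume s: "s \<in> T"
        \<comment> \<open>The sign is moved from \<open>s\<close> to the free factor
          \<open>t\<close>.\<close>
        have "frag_of (?cl \<one>, (\<ominus> s) \<otimes> t) \<in> ?H" if t: "t \<in> carrier S" for t
        proof -
          have "s \<otimes> (\<ominus> t) = (\<ominus> s) \<otimes> t"
            using s t by (simp add: T_def l_minus r_minus)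
          moreover have "frag_of (?cl \<one>, s \<otimes> (\<ominus> t)) \<in> ?H"
            using s t unfolding T_def by blast
          ultimately show ?thesis
            by simp
        qed
        then show "\<ominus> s \<in> T"
          using s by (simp add: T_def)
      next
        show "T \<noteq> {}"
          using T_zero by (auto simp: T_def intro!: exI[of _ \<zero>])
      next
        show "T \<subseteq> carrier S"
          by (auto simp: T_def)
        show "s \<oplus> s' \<in> T" if "s \<in> T" "s' \<in> T" for s s'
          using that T_add by (simp add: T_def l_distr)
      qed
      have mult: "s \<otimes> r \<in> T" if "s \<in> T" "r \<in> carrier S" for s r
        using that by (simp add: T_def m_assoc)
      show "r \<otimes> s \<in> T" "s \<otimes> r \<in> T" if "s \<in> T" "r \<in> carrier S" for s r
        using mult[OF that] m_comm[of r s] that by (simp_all add: T_def)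
    qed
    have "I \<subseteq> T"
    proof
      fix a assume a: "a \<in> I"
      then have aR: "a \<in> R"
        using I.a_subset by auto
      have "?cl a = ?cl \<zero>"
        using I.cyclic_class_eq_iff[of a \<zero>] aR a minus_base[of a \<zero>] by (simp add: minus_eq)
      moreover have "a \<odot>\<^bsub>?M\<^esub> ?cl \<one> = ?cl a"
        using I.smult_cyclic_class[of a \<one>] aR by simp
      ultimately have act: "a \<odot>\<^bsub>?M\<^esub> ?cl \<one> = ?cl \<zero>"
        by simp
      \<comment> \<open>Balancing moves \<open>a\<close> to the left factor, where it turns the
        class of \<open>\<one>\<close> into that of \<open>\<zero>\<close>; additivity in the left
        factor then shows that the pair of the zero class and \<open>t\<close> vanishes.\<close>
      have "frag_of (?cl \<one>, a \<otimes> t) \<in> ?H" if t: "t \<in> carrier S" for t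
      proof -
        have tP: "t \<in> carrier ?P"
          using t by (simp add: ring_as_module_def)
        have aB: "a \<in> carrier base"
          using aR by simp
        have "frag_of (a \<odot>\<^bsub>?M\<^esub> ?cl \<one>, t) - frag_of (?cl \<one>, a \<odot>\<^bsub>?P\<^esub> t)
            \<in> tensor_relators base ?M ?P"
          unfolding tensor_relators_def using cl1 tP aB by blast
        then have 1: "frag_of (?cl \<zero>, t) - frag_of (?cl \<one>, a \<otimes> t) \<in> ?H"
          by (intro rel) (simp add: act ring_as_module_def)
        have "frag_of (?cl \<zero> \<oplus>\<^bsub>?M\<^esub> ?cl \<zero>, t) - frag_of (?cl \<zero>, t) - frag_of (?cl \<zero>, t)
            \<in> tensor_relators base ?M ?P"
          unfolding tensor_relators_def using cl0 tP by blast
        moreover have "?cl \<zero> \<oplus>\<^bsub>?M\<^esub> ?cl \<zero> = ?cl \<zero>"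
          using I.add_cyclic_class[of \<zero> \<zero>] by simp
        ultimately have "frag_of (?cl \<zero>, t) - frag_of (?cl \<zero>, t) - frag_of (?cl \<zero>, t) \<in> ?H"
          by (intro rel) simp
        then have 2: "- frag_of (?cl \<zero>, t) \<in> ?H"
          by simp
        show ?thesis
          using minus[OF plus[OF 1 2]] by simp
      qed
      then show "a \<in> T"
        using aR by (simp add: T_def)
    qed
    then have "y \<in> T"
      using genideal_minimal[OF T_ideal] yI by blast
    then have "frag_of (?cl \<one>, y \<otimes> \<one>) \<in> ?H"
      unfolding T_def by blast
    then show "frag_of (?cl \<one>, y) \<in> ?H"
      using y by simp
  qed
qed

text \<open>The hypothesis \<open>colon\<close> amounts to \<open>(I : u) = I\<close>, and flatness
  carries this over to the extended ideal \<open>IS\<close>. The linear map to which flatness is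
  applied is multiplication by \<open>u\<close> on \<open>R/I\<close>.\<close>

lemma flat_colon_extended_ideal:
  assumes flat: "flat_over S R" and I: "ideal I base" and u: "u \<in> R"
    and colon: "\<And>a. a \<in> R \<Longrightarrow> u \<otimes> a \<in> I \<Longrightarrow> a \<in> I"
    and y: "y \<in> carrier S" "u \<otimes> y \<in> Idl I"
  shows "y \<in> Idl I"
proof -
  let ?M = "cyclic_module base I" and ?P = "ring_as_module S"
  let ?H = "tensor_subgroup base ?M ?P"
  let ?cl = "cyclic_class base I"
  interpret I: ideal I base by fact
  have M: "module base ?M"
    by (rule I.module_cyclic_module[OF cring_base])
  interpret M: module base ?M by fact
  define f where "f = (\<lambda>K. u \<odot>\<^bsub>?M\<^esub> K)"
  have f: "f \<in> module_maps base ?M ?M"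
  proof -
    have "f (a \<odot>\<^bsub>?M\<^esub> K) = a \<odot>\<^bsub>?M\<^esub> f K" if "a \<in> carrier base" "K \<in> carrier ?M" for a K
      using M.smult_assoc1[of u a K] M.smult_assoc1[of a u K] m_comm[of a u] u that
      by (simp add: f_def)
    then show ?thesis
      using u M.smult_r_distr[of u] M.smult_closed[of u]
      unfolding module_maps_def hom_def by (simp add: f_def)
  qed
  have inj: "inj_on f (carrier ?M)"
  proof (rule inj_onI)
    fix K L assume "K \<in> carrier ?M" "L \<in> carrier ?M" and eq: "f K = f L"
    then obtain r s where r: "r \<in> R" "K = ?cl r" and s: "s \<in> R" "L = ?cl s"
      by (auto simp: carrier_cyclic_module)
    then have "?cl (u \<otimes> r) = ?cl (u \<otimes> s)"
      using eq u by (simp add: f_def I.smult_cyclic_class[simplified])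
    then have "u \<otimes> r \<ominus> u \<otimes> s \<in> I"
      using u r s I.cyclic_class_eq_iff[of "u \<otimes> r" "u \<otimes> s"] minus_base by simp
    then have "u \<otimes> (r \<ominus> s) \<in> I"
      using u r s by (simp add: minus_eq r_distr r_minus)
    moreover have "r \<ominus> s \<in> R"
      using r s by (simp add: minus_eq)
    ultimately have "r \<ominus> s \<in> I"
      by (rule colon[rotated])
    then show "K = L"
      using r s I.cyclic_class_eq_iff[of r s] minus_base by simp
  qed
  have zero: "frag_of (f (?cl \<one>), y) \<in> ?H"
  proof -
    interpret H: subgroup ?H "free_Abelian_group (carrier ?M \<times> carrier ?P)"
      by (rule subgroup_tensor_subgroup[OF M module_ring_as_module])
    \<comment> \<open>The balancing relator shifts \<open>u\<close> onto \<open>y\<close>, where the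
      product \<open>u y\<close> lies in \<open>IS\<close> and therefore represents zero.\<close>
    have "frag_of (u \<odot>\<^bsub>?M\<^esub> ?cl \<one>, y) - frag_of (?cl \<one>, u \<odot>\<^bsub>?P\<^esub> y) \<in> tensor_relators base ?M ?P"
    proof -
      have "?cl \<one> \<in> carrier ?M" "y \<in> carrier ?P" "u \<in> carrier base"
        using u y(1) by (auto simp: carrier_cyclic_module ring_as_module_def)
      then show ?thesis
        unfolding tensor_relators_def by blast
    qed
    then have "frag_of (f (?cl \<one>), y) - frag_of (?cl \<one>, u \<otimes> y) \<in> ?H"
      unfolding tensor_subgroup_def f_def by (auto simp: ring_as_module_def intro: generate.incl)
    moreover have "frag_of (?cl \<one>, u \<otimes> y) \<in> ?H"
      using cyclic_tensor_eq_zero_iff[OF I, of "u \<otimes> y"] u y by simp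
    ultimately show ?thesis
      using H.m_closed[of "frag_of (f (?cl \<one>), y) - frag_of (?cl \<one>, u \<otimes> y)"
          "frag_of (?cl \<one>, u \<otimes> y)"] by simp
  qed
  have "?cl \<one> \<in> carrier ?M" "y \<in> carrier ?P"
    using y by (auto simp: carrier_cyclic_module ring_as_module_def)
  then have "frag_of (?cl \<one>, y) \<in> ?H"
    by (rule flat_module_reflects_zero[OF flat[unfolded flat_over_def] M M f inj _ _ zero])
  then show ?thesis
    using cyclic_tensor_eq_zero_iff[OF I y(1)] by simp
qed

section \<open>Collapses along a saturated chain\<close>

lemma genmonoid_closed:
  assumes "V \<subseteq> carrier S"
  shows "genmonoid S V \<subseteq> carrier S"
proof -
  have "submonoid (carrier S) S"
    by (rule submonoid.intro) auto
  then show ?thesis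
    using assms unfolding genmonoid_def by blast
qed

text \<open>The tail \<open>ys\<close> is arbitrary so as to cover both the start of a longer
  collapse and, with \<open>ys\<close> empty and of value \<open>\<one>\<close>, a complete
  one.\<close>

lemma collapse_value_closed:
  assumes "list_all2 (\<lambda>(j, u) (J, U). j \<in> Idl J \<and> u \<in> genmonoid S U) xs C"
    and "\<forall>(J, U) \<in> set C. J \<subseteq> carrier S \<and> U \<subseteq> carrier S"
    and "collapse_value S ys \<in> carrier S"
  shows "collapse_value S (xs @ ys) \<in> carrier S"
  using assms
proof (induction rule: list_all2_induct)
  case (Cons x xs P C)
  obtain j u J U where "x = (j, u)" "P = (J, U)"
    by fastforce
  then show ?case
    using Cons ideal.Icarr[OF genideal_ideal, of J j] genmonoid_closed[of U]
    by auto
qed simp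

text \<open>Induction on the chain, removing the outermost layer each time. The assumption is
  membership in the extension of the first ideal, not vanishing, because membership is what survives
  the removal of a layer and passes to the next, larger ideal.\<close>

lemma collapse_value_in_last_ideal:
  assumes flat: "flat_over S R"
    and "C \<noteq> []" "saturated base C"
    and "list_all2 (\<lambda>(j, u) (J, U). j \<in> Idl J \<and> u \<in> genmonoid S U) xs C"
    and ys: "collapse_value S ys \<in> carrier S"
    and "collapse_value S (xs @ ys) \<in> Idl (fst (hd C))"
  shows "collapse_value S ys \<in> Idl (fst (last C))"
  using assms(2-4,6)
proof (induction C arbitrary: xs)
  case (Cons P C)
  obtain I U where P: "P = (I, U)"
    by fastforce
  obtain j u xs' where xs: "xs = (j, u) # xs'" and j: "j \<in> Idl I" and u: "u \<in> genmonoid S U"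
    and xs': "list_all2 (\<lambda>(j, u) (J, U). j \<in> Idl J \<and> u \<in> genmonoid S U) xs' C"
    using Cons.prems(3) unfolding P by (auto simp: list_all2_Cons2)
  have sat: "ideal K base" "submonoid M base" "conjugate base K M" if "(K, M) \<in> set (P # C)" for K M
    using Cons.prems(2) that unfolding saturated_def complete_chain_def by auto
  have carr: "K \<subseteq> carrier S" "M \<subseteq> carrier S" if "(K, M) \<in> set (P # C)" for K M
    using additive_subgroup.a_subset[OF ideal.axioms(1), OF sat(1)[OF that]]
      submonoid.subset[OF sat(2)[OF that]] by auto
  have I: "ideal I base" and U: "submonoid U base" and conj: "conjugate base I U"
    using sat[of I U] P by auto
  \<comment> \<open>Generating in \<open>S\<close> adds nothing to \<open>U\<close>, which is
    already a monoid there. Hence \<open>u\<close> lies in \<open>R\<close>, as the colon argument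
    demands.\<close>
  have "submonoid U S"
    using U carr[of I U] P unfolding submonoid_def by auto
  then have uU: "u \<in> U"
    using u unfolding genmonoid_def by blast
  then have uR: "u \<in> R"
    using submonoid.subset[OF U] by auto
  interpret J: ideal "Idl I" S
    using carr[of I U] P by (intro genideal_ideal) simp
  define z where "z = collapse_value S (xs' @ ys)"
  have "\<forall>(K, M) \<in> set C. K \<subseteq> carrier S \<and> M \<subseteq> carrier S"
    using carr by fastforce
  then have z: "z \<in> carrier S"
    unfolding z_def by (rule collapse_value_closed[OF xs' _ ys])
  have "u \<otimes> z \<oplus> j \<in> Idl I"
    using Cons.prems(4) by (simp add: P xs z_def)
  then have "(u \<otimes> z \<oplus> j) \<ominus> j \<in> Idl I"
    using j by (simp add: a_minus_def)
  moreover have "(u \<otimes> z \<oplus> j) \<ominus> j = u \<otimes> z"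
    using add.m_assoc[of "u \<otimes> z" j "\<ominus> j"] z uR J.Icarr[OF j] by (simp add: a_minus_def r_neg)
  ultimately have uz: "u \<otimes> z \<in> Idl I"
    by simp
  \<comment> \<open>The first clause of conjugacy is the colon condition for
    \<open>u\<close>.\<close>
  have "\<forall>s\<in>U. \<forall>a\<in>R. s \<otimes> a \<in> I \<longrightarrow> a \<in> I"
    using conj unfolding conjugate_def by simp
  then have zI: "z \<in> Idl I"
    using uU by (intro flat_colon_extended_ideal[OF flat I uR _ z uz]) blast
  show ?case
  proof (cases C)
    case Nil
    then show ?thesis
      using zI xs' by (simp add: P z_def)
  next
    case (Cons Q C')
    have "fst ((P # C) ! i) \<subseteq> fst ((P # C) ! Suc i) \<and> snd ((P # C) ! Suc i) \<subseteq> snd ((P # C) ! i)"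
      if "Suc i < length (P # C)" for i
      using Cons.prems(2) that unfolding saturated_def complete_chain_def by blast
    note chain = this
    \<comment> \<open>Neighbours in \<open>C\<close> are neighbours in \<open>P # C\<close> one
      position later.\<close>
    have satC: "saturated base C"
      using Cons.prems(2) chain[of "Suc _"] unfolding saturated_def complete_chain_def by simp
    have "I \<subseteq> fst (hd C)"
      using chain[of 0] Cons P by simp
    then have "Idl I \<subseteq> Idl (fst (hd C))"
      using Cons by (intro subset_Idl_subset) (use carr[of "fst Q" "snd Q"] in auto)
    then have "collapse_value S (xs' @ ys) \<in> Idl (fst (hd C))"
      using zI unfolding z_def by blast
    then have "collapse_value S ys \<in> Idl (fst (last C))"
      using Cons by (intro Cons.IH[OF _ satC xs']) simp_all
    then show ?thesis
      using Cons by simp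
  qed
qed simp

text \<open>The value of the \<open>C\<^sub>2\<close> part lies in the first ideal \<open>J\<close>
  of \<open>C\<^sub>2\<close>, so it can be absorbed into the outermost summand of that
  part.\<close>

theorem collapse_flat_suffix:
  assumes flat: "flat_over S R" and C1: "C\<^sub>1 \<noteq> []" "saturated base C\<^sub>1"
    and C2: "C\<^sub>2 \<noteq> []" "saturated S C\<^sub>2"
    and sub: "fst (last C\<^sub>1) \<subseteq> fst (hd C\<^sub>2)"
    and coll: "collapses S (C\<^sub>1 @ C\<^sub>2)"
  shows "collapses S C\<^sub>2"
proof -
  let ?P = "\<lambda>(j, u) (J, U). j \<in> Idl J \<and> u \<in> genmonoid S U"
  obtain xs ys where xs: "list_all2 ?P xs C\<^sub>1" and ys: "list_all2 ?P ys C\<^sub>2"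
    and zero: "collapse_value S (xs @ ys) = \<zero>"
    using coll unfolding collapses_def list_all2_append2 by blast
  have carr2: "\<forall>(J, U) \<in> set C\<^sub>2. J \<subseteq> carrier S \<and> U \<subseteq> carrier S"
  proof (safe)
    fix J U x assume "(J, U) \<in> set C\<^sub>2"
    then have "ideal J S" "submonoid U S"
      using C2(2) unfolding saturated_def complete_chain_def by auto
    then show "x \<in> J \<Longrightarrow> x \<in> carrier S" "x \<in> U \<Longrightarrow> x \<in> carrier S"
      using ideal.Icarr submonoid.mem_carrier by metis+
  qed
  have ys_closed: "collapse_value S ys \<in> carrier S"
    using collapse_value_closed[OF ys carr2, of "[]"] by simp
  have "ideal (fst (hd C\<^sub>1)) base"
    using C1 unfolding saturated_def complete_chain_def by (cases C\<^sub>1) auto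
  then have "fst (hd C\<^sub>1) \<subseteq> carrier S"
    using additive_subgroup.a_subset[OF ideal.axioms(1)] by force
  \<comment> \<open>The descent starts here: the whole collapse has value zero, which lies in the
    first extended ideal.\<close>
  then have "\<zero> \<in> Idl (fst (hd C\<^sub>1))"
    by (intro additive_subgroup.zero_closed ideal.axioms(1) genideal_ideal)
  then have last: "collapse_value S ys \<in> Idl (fst (last C\<^sub>1))"
    using zero by (intro collapse_value_in_last_ideal[OF flat C1 xs ys_closed]) simp
  obtain J V C where C: "C\<^sub>2 = (J, V) # C"
    using C2(1) by (metis neq_Nil_conv prod.exhaust)
  have J: "ideal J S"
    using C2(2) C unfolding saturated_def complete_chain_def by auto
  have IdlJ: "Idl J = J"
    using genideal_minimal[OF J] genideal_self[of J] carr2 C by auto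
  obtain j v ys' where ys_eq: "ys = (j, v) # ys'" and j: "j \<in> Idl J" and v: "v \<in> genmonoid S V"
    and ys': "list_all2 ?P ys' C"
    using ys unfolding C by (auto simp: list_all2_Cons2)
  interpret J: ideal J S by fact
  \<comment> \<open>The value of \<open>ys\<close> is \<open>w \<oplus> j\<close>. Replacing
    \<open>j\<close> by \<open>j \<ominus> (w \<oplus> j)\<close>, which is
    \<open>\<ominus> w\<close>, keeps the summand in \<open>J\<close> and makes the value
    vanish.\<close>
  define w where "w = v \<otimes> collapse_value S ys'"
  have w: "w \<in> carrier S"
    using collapse_value_closed[OF ys', of "[]"] carr2 v genmonoid_closed[of V] by (auto simp: w_def C)
  have zJ: "w \<oplus> j \<in> J"
    using last genideal_minimal[OF J, of "fst (last C\<^sub>1)"] sub by (auto simp: C ys_eq w_def)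
  have "list_all2 ?P ((j \<ominus> (w \<oplus> j), v) # ys') C\<^sub>2"
    using ys' v j zJ by (simp add: C IdlJ a_minus_def)
  moreover have "w \<oplus> (j \<ominus> (w \<oplus> j)) = \<zero>"
    using a_assoc[of w j "\<ominus> (w \<oplus> j)"] r_neg[of "w \<oplus> j"] w J.Icarr[of j] j
    by (simp add: IdlJ a_minus_def)
  then have "collapse_value S ((j \<ominus> (w \<oplus> j), v) # ys') = \<zero>"
    by (simp add: w_def)
  ultimately show ?thesis
    unfolding collapses_def by blast
qed

end

text \<open>A collapse gives \<open>j + v = 0\<close>, and completeness, in the form
  \<open>J + V = V\<close>, puts zero into \<open>V\<close>. Zero lies in \<open>R\<close> too, so
  it belongs to both components of the trace.\<close>

lemma collapses_trace_prime:
  assumes "ring S" "subring R S" "saturated S [(J, V)]" "collapses S [(J, V)]"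
  shows "collapses (S\<lparr>carrier := R\<rparr>) [trace_prime R (J, V)]"
proof -
  interpret ring S by fact
  let ?A = "S\<lparr>carrier := R\<rparr>"
  have J: "ideal J S" and V: "submonoid V S" and sum: "J <+>\<^bsub>S\<^esub> V = V"
    using assms(3) unfolding saturated_def complete_chain_def by auto
  interpret J: ideal J S by fact
  obtain j v where j: "j \<in> genideal S J" and v: "v \<in> genmonoid S V"
    and zero: "v \<otimes>\<^bsub>S\<^esub> \<one>\<^bsub>S\<^esub> \<oplus>\<^bsub>S\<^esub> j = \<zero>\<^bsub>S\<^esub>"
    using assms(4) unfolding collapses_def by (auto simp: list_all2_Cons2)
  have jJ: "j \<in> J"
    using j genideal_minimal[OF J order_refl] by blast
  have vV: "v \<in> V"
    using v V unfolding genmonoid_def by blast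
  have "j \<oplus>\<^bsub>S\<^esub> v = \<zero>\<^bsub>S\<^esub>"
    using zero J.Icarr[OF jJ] submonoid.mem_carrier[OF V vV] a_comm[of v j] by simp
  then have "\<zero>\<^bsub>S\<^esub> \<in> J <+>\<^bsub>S\<^esub> V"
    using jJ vV unfolding set_add_def' by blast
  then have "\<zero>\<^bsub>S\<^esub> \<in> V \<inter> R"
    using sum subringE(2)[OF assms(2)] by simp
  then have "\<zero>\<^bsub>S\<^esub> \<in> genmonoid ?A (V \<inter> R)" "\<zero>\<^bsub>S\<^esub> \<in> genideal ?A (J \<inter> R)"
    unfolding genmonoid_def genideal_def by auto
  then show ?thesis
    \<comment> \<open>With both entries zero the value is \<open>0 * 1 + 0\<close>, the factor
      \<open>1\<close> being the value of the empty list.\<close>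
    unfolding collapses_def trace_prime_def
    by (intro exI[of _ "[(\<zero>\<^bsub>S\<^esub>, \<zero>\<^bsub>S\<^esub>)]"]) simp
qed

theorem theorem4p19:
  fixes S :: "('a, 'b) ring_scheme" and R :: "'a set"
  assumes "cring S" and "subcring R S" and "flat_over S R"
  shows "(\<forall>J\<^sub>1 V\<^sub>1 I\<^sub>1 U\<^sub>1 I\<^sub>0 U\<^sub>0.
            saturated S [(J\<^sub>1, V\<^sub>1)] \<and>
            (I\<^sub>1, U\<^sub>1) = trace_prime R (J\<^sub>1, V\<^sub>1) \<and>
            saturated (S\<lparr>carrier := R\<rparr>) [(I\<^sub>0, U\<^sub>0)] \<and>
            I\<^sub>0 \<subseteq> I\<^sub>1 \<and>
            collapses S [(I\<^sub>0, U\<^sub>0), (J\<^sub>1, V\<^sub>1)]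
            \<longrightarrow> collapses S [(J\<^sub>1, V\<^sub>1)] \<and> collapses (S\<lparr>carrier := R\<rparr>) [(I\<^sub>1, U\<^sub>1)])
       \<and> (\<forall>C\<^sub>1 C\<^sub>2.
            C\<^sub>1 \<noteq> [] \<and> C\<^sub>2 \<noteq> [] \<and>
            saturated (S\<lparr>carrier := R\<rparr>) C\<^sub>1 \<and>
            saturated S C\<^sub>2 \<and>
            fst (last C\<^sub>1) \<subseteq> fst (trace_chain R C\<^sub>2 ! 0) \<and>
            collapses S (C\<^sub>1 @ C\<^sub>2)
            \<longrightarrow> collapses S C\<^sub>2)"
proof -
  interpret cring_extension S R
    using assms by (simp add: cring_extension_def)
  have suffix: "collapses S C\<^sub>2"
    if "C\<^sub>1 \<noteq> []" "C\<^sub>2 \<noteq> []" "saturated base C\<^sub>1" "saturated S C\<^sub>2"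
      "fst (last C\<^sub>1) \<subseteq> fst (trace_chain R C\<^sub>2 ! 0)" "collapses S (C\<^sub>1 @ C\<^sub>2)" for C\<^sub>1 C\<^sub>2
  proof (rule collapse_flat_suffix[OF assms(3) that(1,3,2,4) _ that(6)])
    \<comment> \<open>The first ideal of the trace is an intersection with \<open>R\<close>, so it
      is contained in the first ideal of \<open>C\<^sub>2\<close>.\<close>
    show "fst (last C\<^sub>1) \<subseteq> fst (hd C\<^sub>2)"
      using that(2,5) by (cases C\<^sub>2) (auto simp: trace_chain_def trace_prime_def)
  qed
  moreover have "collapses S [(J\<^sub>1, V\<^sub>1)] \<and> collapses base [(I\<^sub>1, U\<^sub>1)]"
    if "saturated S [(J\<^sub>1, V\<^sub>1)]" "(I\<^sub>1, U\<^sub>1) = trace_prime R (J\<^sub>1, V\<^sub>1)"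
      "saturated base [(I\<^sub>0, U\<^sub>0)]" "I\<^sub>0 \<subseteq> I\<^sub>1" "collapses S [(I\<^sub>0, U\<^sub>0), (J\<^sub>1, V\<^sub>1)]"
    for J\<^sub>1 V\<^sub>1 I\<^sub>1 U\<^sub>1 I\<^sub>0 U\<^sub>0
  proof -
    have sub: "I\<^sub>0 \<subseteq> fst (trace_prime R (J\<^sub>1, V\<^sub>1))"
      using that(2,4) by (metis fst_conv)
    \<comment> \<open>The first claim is the case of two chains with one member each.\<close>
    have "collapses S [(J\<^sub>1, V\<^sub>1)]"
      by (rule suffix[of "[(I\<^sub>0, U\<^sub>0)]"]; use sub that(1,3,5) in \<open>simp add: trace_chain_def\<close>)
    then show ?thesis
      using collapses_trace_prime[OF ring_axioms subring_axioms that(1)] unfolding that(2) by blast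
  qed
  ultimately show ?thesis
    by (intro conjI allI impI; elim conjE) (simp only:)+
qed

end
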